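(* For every integer $n \geq 5$, Left wins the Forbidden Leaf Variant of the Mixed Deletion Game played on the complete graph $K_n$ regardless of which player moves first.
   Context: The Classic Variant of the Mixed Deletion Game is a two-player combinatorial game between Left and Right played on a finite simple undirected graph; players alternate turns. On her turn Left deletes one vertex together with all edges incident to it; on his turn Right deletes one edge. The game ends when a deletion creates an isolated vertex (a vertex of degree $0$), and the player whose deletion created an isolated vertex loses; thus a legal move is a deletion which does not create an isolated vertex, and a player with no legal move loses. The Forbidden Leaf Variant has the same rules with the additional restriction that Left may not delete a leaf (a vertex of degree $1$). $K_n$ denotes the complete graph on $n$ vertices. *)

theory Defs
  imports Main
begin

text \<open>A graph is a pair of a vertex set and a set of edges, each edge being the
  two-element set of its endpoints.\<close>

type_synonym 'a graph = "'a set \<times> 'a set set"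

definition complete_graph :: "'a set \<Rightarrow> 'a graph" where
  "complete_graph V = (V, {e. e \<subseteq> V \<and> card e = 2})"

definition degree :: "'a graph \<Rightarrow> 'a \<Rightarrow> nat" where
  "degree G v = card {e \<in> snd G. v \<in> e}"

definition isolated :: "'a graph \<Rightarrow> 'a \<Rightarrow> bool" where
  "isolated G v \<longleftrightarrow> v \<in> fst G \<and> degree G v = 0"

definition leaf :: "'a graph \<Rightarrow> 'a \<Rightarrow> bool" where
  "leaf G v \<longleftrightarrow> v \<in> fst G \<and> degree G v = 1"

definition delete_vertex :: "'a graph \<Rightarrow> 'a \<Rightarrow> 'a graph" where
  "delete_vertex G v = (fst G - {v}, {e \<in> snd G. v \<notin> e})"

definition delete_edge :: "'a graph \<Rightarrow> 'a set \<Rightarrow> 'a graph" where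
  "delete_edge G e = (fst G, snd G - {e})"

definition creates_isolated :: "'a graph \<Rightarrow> 'a graph \<Rightarrow> bool" where
  "creates_isolated G G' \<longleftrightarrow> (\<exists>v. isolated G' v \<and> \<not> isolated G v)"

datatype player = Left | Right

fun opponent :: "player \<Rightarrow> player" where
  "opponent Left = Right"
| "opponent Right = Left"

text \<open>The moves below are the legal ones. A deletion that creates an isolated vertex
  loses at once for the player making it, so it is left out, and a player without
  legal moves loses.\<close>

fun forbidden_leaf_move :: "player \<Rightarrow> 'a graph \<Rightarrow> 'a graph \<Rightarrow> bool" where
  "forbidden_leaf_move Left G G' \<longleftrightarrow>
     (\<exists>v \<in> fst G. \<not> leaf G v \<and> G' = delete_vertex G v \<and> \<not> creates_isolated G G')"
| "forbidden_leaf_move Right G G' \<longleftrightarrow>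
     (\<exists>e \<in> snd G. G' = delete_edge G e \<and> \<not> creates_isolated G G')"

text \<open>\<open>wins move p q G\<close>: player \<open>p\<close> has a winning strategy from position \<open>G\<close> when
  \<open>q\<close> is the player to move. The least fixed point is the right one because every move
  shrinks a finite graph, so play terminates. Its base case is the second rule when
  the opponent has no move.\<close>

inductive wins ::
    "(player \<Rightarrow> 'g \<Rightarrow> 'g \<Rightarrow> bool) \<Rightarrow> player \<Rightarrow> player \<Rightarrow> 'g \<Rightarrow> bool"
  for move :: "player \<Rightarrow> 'g \<Rightarrow> 'g \<Rightarrow> bool" and p :: player where
  own_turn: "move p G G' \<Longrightarrow> wins move p (opponent p) G' \<Longrightarrow> wins move p p G"
| opponents_turn: "(\<And>G'. move (opponent p) G G' \<Longrightarrow> wins move p p G') \<Longrightarrow>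
     wins move p (opponent p) G"

end

theory Submission
  imports Defs
begin

text \<open>Whenever Right deletes an edge of \<open>K\<^sub>m\<close>, Left answers by deleting one of its endpoints,
  which restores a complete graph, now \<open>K\<^sub>m\<^sub>-\<^sub>1\<close>. From \<open>K\<^sub>4\<close> Left instead deletes a vertex off the
  deleted edge: this leaves a path with two edges, where Right has no legal move. Moving first
  on \<open>K\<^sub>n\<close> with \<open>n \<ge> 5\<close>, Left passes to \<open>K\<^sub>n\<^sub>-\<^sub>1\<close>.\<close>

text \<open>The finiteness hypothesis guards against the default \<open>card\<close> of an infinite
  set being 0, which would make \<open>degree\<close> vanish despite the edge
  \<open>e\<close>.\<close>

lemma not_isolatedI:
  assumes "finite (snd G)" "e \<in> snd G" "v \<in> e"
  shows "\<not> isolated G v"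
  using assms by (auto simp: isolated_def degree_def)

lemma not_leafI:
  assumes "finite (snd G)" "e \<in> snd G" "f \<in> snd G" "v \<in> e" "v \<in> f" "e \<noteq> f"
  shows "\<not> leaf G v"
proof -
  have "card {e, f} \<le> degree G v"
    unfolding degree_def using assms by (intro card_mono) auto
  with \<open>e \<noteq> f\<close> show ?thesis by (simp add: leaf_def)
qed

lemma fst_complete_graph [simp]: "fst (complete_graph V) = V"
  by (simp add: complete_graph_def)

lemma finite_complete_graph: "finite V \<Longrightarrow> finite (snd (complete_graph V))"
  by (simp add: complete_graph_def)

lemma edge_complete_graph [simp]:
  "{u, v} \<in> snd (complete_graph V) \<longleftrightarrow> u \<in> V \<and> v \<in> V \<and> u \<noteq> v"
  by (auto simp: complete_graph_def card_2_iff doubleton_eq_iff)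

lemma delete_vertex_complete_graph:
  "delete_vertex (complete_graph V) u = complete_graph (V - {u})"
  by (auto simp: delete_vertex_def complete_graph_def)

text \<open>The edge \<open>e\<close> would vanish with its endpoint \<open>u\<close> anyway. Hence
  Left's reply at an endpoint undoes the damage done by Right.\<close>

lemma delete_vertex_delete_edge:
  "u \<in> e \<Longrightarrow> delete_vertex (delete_edge G e) u = delete_vertex G u"
  by (auto simp: delete_vertex_def delete_edge_def)

lemma ex_in_diff_of_card_less:
  assumes "finite A" "card A < card V"
  shows "\<exists>w\<in>V. w \<notin> A"
  using assms by (meson card_mono leD subsetI)

lemma complete_graph_not_isolated:
  assumes "finite V" "card V \<ge> 2"
  shows "\<not> isolated (complete_graph V) v"
proof (cases "v \<in> V")
  case True
  obtain w where "w \<in> V" "w \<notin> {v}"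
    using assms ex_in_diff_of_card_less[of "{v}" V] by auto
  with True show ?thesis
    by (intro not_isolatedI[of _ "{v, w}"]) (auto simp: finite_complete_graph assms)
qed (simp add: isolated_def)

text \<open>In a star with centre \<open>d\<close>, the edge \<open>{d, x}\<close> is the only one
  at \<open>x\<close>, so its deletion isolates \<open>x\<close>.\<close>

lemma star_right_stuck:
  assumes "d \<notin> L"
  shows "\<not> forbidden_leaf_move Right (insert d L, (\<lambda>x. {d, x}) ` L) G'"
proof -
  let ?G = "(insert d L, (\<lambda>x. {d, x}) ` L)"
  have "creates_isolated ?G (delete_edge ?G {d, x})" if "x \<in> L" for x
  proof -
    have "{e \<in> snd ?G. x \<in> e} = {{d, x}}" using that assms by auto
    moreover have "{e \<in> snd (delete_edge ?G {d, x}). x \<in> e} = {}"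
      using that assms by (auto simp: delete_edge_def)
    ultimately have "degree ?G x = 1" "degree (delete_edge ?G {d, x}) x = 0"
      by (simp_all only: degree_def card.empty card_1_singleton_iff) simp
    then have "isolated (delete_edge ?G {d, x}) x" "\<not> isolated ?G x"
      using that by (simp_all add: isolated_def delete_edge_def)
    then show ?thesis by (auto simp: creates_isolated_def)
  qed
  then show ?thesis by auto
qed

text \<open>With \<open>opponent Left\<close> evaluated to \<open>Right\<close>, the rule applies
  directly to goals that name the player.\<close>

lemma wins_Left_Right_turnI:
  assumes "\<And>G'. move Right G G' \<Longrightarrow> wins move Left Left G'"
  shows "wins move Left Right G"
  using opponents_turn[of move Left G] assms by simp

lemma wins_Left_Left_turnI:
  assumes "v \<in> fst G" "\<not> leaf G v" "\<not> creates_isolated G (delete_vertex G v)"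
    and "wins forbidden_leaf_move Left Right (delete_vertex G v)"
  shows "wins forbidden_leaf_move Left Left G"
  using own_turn[of forbidden_leaf_move Left G "delete_vertex G v"] assms by auto

text \<open>Of the six edges, Right removed \<open>{u, v}\<close> and three go with
  \<open>c\<close>. The other two both meet \<open>d\<close>, and they are written as a star to
  match \<open>star_right_stuck\<close>.\<close>

lemma delete_vertex_K4_minus_edge:
  assumes "distinct [u, v, c, d]"
  shows "delete_vertex (delete_edge (complete_graph {u, v, c, d}) {u, v}) c =
         (insert d {u, v}, (\<lambda>x. {d, x}) ` {u, v})"
  using assms
  by (auto simp: delete_vertex_def delete_edge_def complete_graph_def card_2_iff doubleton_eq_iff)

lemma Left_wins_K4_minus_edge:
  assumes "distinct [u, v, c, d]"
  shows "wins forbidden_leaf_move Left Left (delete_edge (complete_graph {u, v, c, d}) {u, v})"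
    (is "wins _ _ _ ?G")
proof (rule wins_Left_Left_turnI[where v = c])
  have fin: "finite (snd ?G)" by (simp add: delete_edge_def finite_complete_graph)
  show "c \<in> fst ?G" by (simp add: delete_edge_def)
  show "\<not> leaf ?G c"
    by (rule not_leafI[OF fin, of "{c, u}" "{c, v}"])
      (use assms in \<open>auto simp: delete_edge_def doubleton_eq_iff\<close>)
  have "\<not> isolated (insert d {u, v}, (\<lambda>x. {d, x}) ` {u, v}) x" for x
  proof (cases "x \<in> {u, v, d}")
    case True
    then show ?thesis
      \<comment> \<open>The centre is covered by its edge to \<open>u\<close>, each outer vertex by
        its edge to the centre.\<close>
      by (intro not_isolatedI[of _ "{d, if x = d then u else x}"]) auto
  qed (simp add: isolated_def)
  then show "\<not> creates_isolated ?G (delete_vertex ?G c)"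
    unfolding delete_vertex_K4_minus_edge[OF assms] creates_isolated_def by blast
  show "wins forbidden_leaf_move Left Right (delete_vertex ?G c)"
    unfolding delete_vertex_K4_minus_edge[OF assms]
    by (rule wins_Left_Right_turnI) (use star_right_stuck[of d "{u, v}"] assms in auto)
qed

lemma Left_wins_second_complete_graph:
  assumes "finite V" "card V \<ge> 4"
  shows "wins forbidden_leaf_move Left Right (complete_graph V)"
  using assms
proof (induction "card V" arbitrary: V rule: less_induct)
  case less
  show ?case
  proof (rule wins_Left_Right_turnI)
    fix G' assume "forbidden_leaf_move Right (complete_graph V) G'"
    then obtain u v where uv: "u \<in> V" "v \<in> V" "u \<noteq> v"
      and G': "G' = delete_edge (complete_graph V) {u, v}"
      by (auto simp: complete_graph_def card_2_iff)
    \<comment> \<open>If \<open>card V = 4\<close>, then \<open>c\<close> and \<open>d\<close> are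
      all the remaining vertices. Otherwise they are two surviving neighbours of \<open>u\<close>,
      so \<open>u\<close> is no leaf.\<close>
    obtain c where c: "c \<in> V" "c \<notin> {u, v}"
      using less.prems uv ex_in_diff_of_card_less[of "{u, v}" V] by auto
    obtain d where d: "d \<in> V" "d \<notin> {u, v, c}"
      using less.prems uv c ex_in_diff_of_card_less[of "{u, v, c}" V] by auto
    show "wins forbidden_leaf_move Left Left G'"
    proof (cases "card V = 4")
      \<comment> \<open>Restoring a complete graph fails here: from a triangle Right leaves a path
        with two edges, where Left may not delete an end and deleting the middle isolates both
        ends.\<close>
      case True
      then have "{u, v, c, d} = V"
        using uv c d less.prems by (intro card_subset_eq) auto
      then show ?thesis
        using Left_wins_K4_minus_edge[of u v c d] uv c d by (auto simp: G')
    next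
      case False
      have card: "card (V - {u}) = card V - 1" using uv by simp
      have del: "delete_vertex G' u = complete_graph (V - {u})"
        by (simp add: G' delete_vertex_delete_edge delete_vertex_complete_graph)
      have fin: "finite (snd G')"
        using less.prems by (simp add: G' delete_edge_def finite_complete_graph)
      show ?thesis
      proof (rule wins_Left_Left_turnI)
        show "u \<in> fst G'" using uv by (simp add: G' delete_edge_def)
        show "\<not> leaf G' u"
          by (rule not_leafI[OF fin, of "{u, c}" "{u, d}"])
            (use uv c d in \<open>auto simp: G' delete_edge_def doubleton_eq_iff\<close>)
        show "\<not> creates_isolated G' (delete_vertex G' u)"
          using complete_graph_not_isolated[of "V - {u}"] less.prems card
          by (simp add: del creates_isolated_def)
        show "wins forbidden_leaf_move Left Right (delete_vertex G' u)"
          unfolding del using less.prems card False by (intro less.hyps) auto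
      qed
    qed
  qed
qed

theorem theorem3p13:
  fixes n :: nat and first :: player
  assumes "n \<ge> 5"
  shows "wins forbidden_leaf_move Left first (complete_graph {0..<n})"
proof (cases first)
  case Right
  then show ?thesis using assms by (simp add: Left_wins_second_complete_graph)
next
  case Left
  let ?K = "complete_graph {0..<n}"
  have del: "delete_vertex ?K 0 = complete_graph ({0..<n} - {0})"
    by (rule delete_vertex_complete_graph)
  have "wins forbidden_leaf_move Left Left ?K"
  proof (rule wins_Left_Left_turnI)
    show "0 \<in> fst ?K" using assms by simp
    show "\<not> leaf ?K 0"
      by (rule not_leafI[of _ "{0, 1}" "{0, 2}"])
        (use assms in \<open>auto simp: finite_complete_graph doubleton_eq_iff\<close>)
    show "\<not> creates_isolated ?K (delete_vertex ?K 0)"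
      using complete_graph_not_isolated[of "{0..<n} - {0}"] assms
      by (simp add: del creates_isolated_def)
    \<comment> \<open>The bound \<open>n \<ge> 5\<close> leaves at least the four vertices needed
      for Left to win as second player.\<close>
    show "wins forbidden_leaf_move Left Right (delete_vertex ?K 0)"
      unfolding del using assms by (intro Left_wins_second_complete_graph) auto
  qed
  with Left show ?thesis by simp
qed

end
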